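(* For every $\lambda>2$, $\mathcal{T}_{\mathbb{R}}(\Omega_\lambda)\ge2$.
   Context: For $\lambda\ge 0$ let $\Omega_\lambda=(-1,1)\cup(\lambda-1,\lambda+1)\cup(-\lambda-1,-\lambda+1)\subset\mathbb{R}$. A function $f:\mathbb{R}\to\mathbb{C}$ is positive definite if $\sum_{j,k=1}^m z_j\overline{z_k}f(x_j-x_k)\ge 0$ for all finite choices of $x_1,\dots,x_m\in\mathbb{R}$ and $z_1,\dots,z_m\in\mathbb{C}$. For an open bounded set $\Omega\subset\mathbb{R}$ with $\Omega=-\Omega$ and $0\in\Omega$, the Turán constant is $$\mathcal{T}_{\mathbb{R}}(\Omega)=\sup\left\{\int_{\mathbb{R}}f(x)\,dx: f\in C(\mathbb{R}),\ f \text{ positive definite},\ f(0)=1,\ \operatorname{supp} f\subset\Omega\right\},$$ where $\operatorname{supp} f$ is the closed support of $f$ (the integrals in question are automatically real). *)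

theory Defs
  imports "HOL-Analysis.Analysis"
begin

text \<open>Membership in \<open>\<real>\<^sub>\<ge>\<^sub>0\<close> says that the complex number is real and nonnegative.\<close>

definition positive_definite :: "(real \<Rightarrow> complex) \<Rightarrow> bool" where
  "positive_definite f \<longleftrightarrow>
    (\<forall>(m::nat) (x::nat \<Rightarrow> real) (z::nat \<Rightarrow> complex).
      (\<Sum>j<m. \<Sum>k<m. z j * cnj (z k) * f (x j - x k)) \<in> \<real>\<^sub>\<ge>\<^sub>0)"

definition turan_admissible :: "real set \<Rightarrow> (real \<Rightarrow> complex) \<Rightarrow> bool" where
  "turan_admissible \<Omega> f \<longleftrightarrow>
    continuous_on UNIV f \<and> positive_definite f \<and> f 0 = 1 \<and> closure (support_on UNIV f) \<subseteq> \<Omega>"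

text \<open>
  The notion is meant for open bounded \<open>\<Omega> = -\<Omega>\<close> containing 0. An admissible function is then
  continuous with compact support, hence integrable, and it satisfies \<open>f (-x) = cnj (f x)\<close>,
  so its integral is real and \<open>Re\<close> loses nothing. The supremum is taken in the extended
  reals, where it is meaningful without a proof of boundedness.
\<close>

definition turan_constant :: "real set \<Rightarrow> ereal" where
  "turan_constant \<Omega> = (SUP f \<in> {f. turan_admissible \<Omega> f}. ereal (Re (\<integral>x. f x \<partial>lborel)))"

definition Omega :: "real \<Rightarrow> real set" where
  "Omega l = {-1<..<1} \<union> {l - 1<..<l + 1} \<union> {- l - 1<..<- l + 1}"

lemma Omega_domain:
  "open (Omega l)" "bounded (Omega l)" "uminus ` Omega l = Omega l" "0 \<in> Omega l"
proof -
  show "uminus ` Omega l = Omega l"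
    by (auto simp: Omega_def image_Un)
qed (auto simp: Omega_def intro!: open_Un)

end

theory Submission
  imports Defs
begin

text \<open>
  The lower bound comes from autocorrelations. For a real function \<open>H\<close> the function
  \<open>x \<mapsto> \<integral> H (t + x) H t dt\<close> is positive definite, because its quadratic form is
  \<open>\<integral> |\<Sum>\<^sub>j z\<^sub>j H (t + x\<^sub>j)|\<^sup>2 dt\<close>. Take for \<open>H\<close> the indicator of two intervals of
  length \<open>r < 1\<close> whose left ends are \<open>l\<close> apart. Its autocorrelation consists of a tent of
  height \<open>2 r\<close> over \<open>[-r, r]\<close> and two tents of height \<open>r\<close> centred at \<open>l\<close> and \<open>-l\<close>; so it is
  supported in the three intervals of \<open>Omega l\<close>. Its value at the origin is \<open>2 r\<close>, as the
  two outer tents do not reach there. A tent of height \<open>r\<close> and half-width \<open>r\<close> has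
  integral \<open>r\<^sup>2\<close>, so after normalisation the integral is
  \<open>4 r\<^sup>2 / (2 r) = 2 r\<close>. The closed support has to lie in the open set \<open>Omega l\<close>, which
  excludes \<open>r = 1\<close>; letting \<open>r\<close> tend to 1 from below gives the bound 2.
\<close>

section \<open>Positive definiteness of autocorrelations\<close>

text \<open>
  By translation invariance the autocorrelation \<open>F\<close> of \<open>H\<close> satisfies
  \<open>F (x\<^sub>j - x\<^sub>k) = \<integral> H (t + x\<^sub>j) H (t + x\<^sub>k) dt\<close>, so the
  quadratic form is the integral of a squared modulus.
\<close>

lemma positive_definite_autocorrelation:
  fixes H :: "real \<Rightarrow> real"
  assumes int: "\<And>x. integrable lborel (\<lambda>t. H (t + x) * H t)"
  shows "positive_definite (\<lambda>x. complex_of_real (\<integral>t. H (t + x) * H t \<partial>lborel))"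
  unfolding positive_definite_def
proof (intro allI)
  fix m :: nat and x :: "nat \<Rightarrow> real" and z :: "nat \<Rightarrow> complex"
  let ?G = "\<lambda>t. \<Sum>j<m. z j * of_real (H (t + x j))"
  have shift: "has_bochner_integral lborel (\<lambda>t. H (t + a) * H (t + b))
      (\<integral>t. H (t + (a - b)) * H t \<partial>lborel)" for a b
    using lborel_has_bochner_integral_real_affine_iff[of 1
        "\<lambda>t. H (t + (a - b)) * H t" "\<integral>t. H (t + (a - b)) * H t \<partial>lborel" b]
      has_bochner_integral_integrable[OF int[of "a - b"]]
    by (simp add: algebra_simps)
  have "has_bochner_integral lborel
      (\<lambda>t. \<Sum>j<m. \<Sum>k<m. z j * cnj (z k) * of_real (H (t + x j) * H (t + x k)))
      (\<Sum>j<m. \<Sum>k<m. z j * cnj (z k) *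
         of_real (\<integral>t. H (t + (x j - x k)) * H t \<partial>lborel))"
    by (intro has_bochner_integral_sum has_bochner_integral_mult_right
        has_bochner_integral_of_real shift)
  moreover have "(\<Sum>j<m. \<Sum>k<m. z j * cnj (z k) * of_real (H (t + x j) * H (t + x k)))
      = of_real ((cmod (?G t))\<^sup>2)" for t
    unfolding complex_norm_square
    by (simp add: sum_product algebra_simps)
  ultimately have "(\<Sum>j<m. \<Sum>k<m. z j * cnj (z k) *
         of_real (\<integral>t. H (t + (x j - x k)) * H t \<partial>lborel))
      = (\<integral>t. complex_of_real ((cmod (?G t))\<^sup>2) \<partial>lborel)"
    by (simp add: has_bochner_integral_iff)
  also have "\<dots> = of_real (\<integral>t. (cmod (?G t))\<^sup>2 \<partial>lborel)"
    by (rule integral_complex_of_real)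
  also have "\<dots> \<in> \<real>\<^sub>\<ge>\<^sub>0"
    by simp
  finally show "(\<Sum>j<m. \<Sum>k<m. z j * cnj (z k) *
      complex_of_real (\<integral>t. H (t + (x j - x k)) * H t \<partial>lborel)) \<in> \<real>\<^sub>\<ge>\<^sub>0" .
qed

lemma positive_definite_scale:
  assumes "positive_definite f" "c \<ge> 0"
  shows "positive_definite (\<lambda>x. of_real c * f x)"
  unfolding positive_definite_def
proof (intro allI)
  fix m :: nat and x :: "nat \<Rightarrow> real" and z :: "nat \<Rightarrow> complex"
  have "of_real c * (\<Sum>j<m. \<Sum>k<m. z j * cnj (z k) * f (x j - x k)) \<in> \<real>\<^sub>\<ge>\<^sub>0"
    using assms by (intro nonneg_Reals_mult_I) (auto simp: positive_definite_def)
  then show "(\<Sum>j<m. \<Sum>k<m. z j * cnj (z k) * (of_real c * f (x j - x k))) \<in> \<real>\<^sub>\<ge>\<^sub>0"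
    by (simp add: sum_distrib_left mult_ac)
qed

section \<open>Tents\<close>

definition tent :: "real \<Rightarrow> real \<Rightarrow> real" where
  "tent r x = max 0 (r - \<bar>x\<bar>)"

lemma continuous_on_tent [continuous_intros]:
  "continuous_on A g \<Longrightarrow> continuous_on A (\<lambda>x. tent r (g x))"
  unfolding tent_def by (intro continuous_intros)

text \<open>
  Tents are overlaps of intervals of equal length; this identifies the terms of the
  autocorrelation of a union of such intervals.
\<close>

lemma has_bochner_integral_overlap:
  fixes a b r x :: real
  assumes "r \<ge> 0"
  shows "has_bochner_integral lborel
    (\<lambda>t. indicator {a..a + r} (t + x) * indicator {b..b + r} t) (tent r (x + b - a))"
proof -
  have eq: "indicator {a..a + r} (t + x) * indicator {b..b + r} t
      = (indicator {max (a - x) b..min (a - x + r) (b + r)} t :: real)" for t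
    by (auto simp: indicator_def)
  have "emeasure lborel {max (a - x) b..min (a - x + r) (b + r)} < \<infinity>"
    by (simp add: emeasure_lborel_Icc_eq)
  moreover have "measure lborel {max (a - x) b..min (a - x + r) (b + r)} = tent r (x + b - a)"
    using assms by (auto simp: tent_def measure_def emeasure_lborel_Icc_eq)
  ultimately show ?thesis
    unfolding eq using has_bochner_integral_real_indicator[of
      "{max (a - x) b..min (a - x + r) (b + r)}" lborel] by simp
qed

lemma has_bochner_integral_tent:
  assumes r: "r \<ge> 0"
  shows "has_bochner_integral lborel (\<lambda>x. tent r (x + c)) (r\<^sup>2)"
proof -
  have left: "((\<lambda>x. tent r x) has_integral r\<^sup>2 / 2) {-r..0}"
  proof -
    have "((\<lambda>x. r + x) has_integral (r * 0 + 0\<^sup>2 / 2) - (r * (-r) + (-r)\<^sup>2 / 2)) {-r..0}"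
      using r by (intro fundamental_theorem_of_calculus)
        (auto intro!: derivative_eq_intros simp flip: has_real_derivative_iff_has_vector_derivative)
    then show ?thesis
      by (subst has_integral_cong[where g = "\<lambda>x. r + x"])
        (auto simp: tent_def power2_eq_square)
  qed
  have right: "((\<lambda>x. tent r x) has_integral r\<^sup>2 / 2) {0..r}"
  proof -
    have "((\<lambda>x. r - x) has_integral (r * r - r\<^sup>2 / 2) - (r * 0 - 0\<^sup>2 / 2)) {0..r}"
      using r by (intro fundamental_theorem_of_calculus)
        (auto intro!: derivative_eq_intros simp flip: has_real_derivative_iff_has_vector_derivative)
    then show ?thesis
      by (subst has_integral_cong[where g = "\<lambda>x. r - x"])
        (auto simp: tent_def power2_eq_square)
  qed
  have "((\<lambda>x. tent r x) has_integral r\<^sup>2) {-r..r}"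
    using has_integral_combine[OF _ _ left right] r by simp
  then have "((\<lambda>x. tent r x) has_integral r\<^sup>2) UNIV"
    by (rule has_integral_on_superset) (auto simp: tent_def)
  then have "has_bochner_integral lborel (tent r) (r\<^sup>2)"
    by (intro has_bochner_integral_nn_integral nn_integral_has_integral_lborel)
       (auto simp: tent_def[abs_def])
  then show ?thesis
    using lborel_has_bochner_integral_real_affine_iff[of 1 "tent r" "r\<^sup>2" c]
    by (simp add: add.commute)
qed

section \<open>The autocorrelation of two intervals\<close>

definition three_tents :: "real \<Rightarrow> real \<Rightarrow> real \<Rightarrow> real" where
  "three_tents l r x = 2 * tent r x + tent r (x + l) + tent r (x - l)"

text \<open>
  The product expands into four overlaps: the two of an interval with itself give the central
  tent twice, the two mixed ones give the outer tents.
\<close>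

lemma three_tents_autocorrelation:
  fixes l r :: real
  defines "H \<equiv> \<lambda>t. indicator {0..0 + r} t + indicator {l..l + r} t"
  assumes "r \<ge> 0"
  shows "has_bochner_integral lborel (\<lambda>t. H (t + x) * H t) (three_tents l r x)"
proof -
  let ?I = "\<lambda>a t. indicator {a..a + r} t :: real"
  have "has_bochner_integral lborel
     (\<lambda>t. (?I 0 (t + x) * ?I 0 t + ?I l (t + x) * ?I l t)
        + (?I 0 (t + x) * ?I l t + ?I l (t + x) * ?I 0 t))
     ((tent r (x + 0 - 0) + tent r (x + l - l)) + (tent r (x + l - 0) + tent r (x + 0 - l)))"
    by (intro has_bochner_integral_add has_bochner_integral_overlap assms)
  then show ?thesis
    by (simp add: H_def three_tents_def algebra_simps)
qed

lemma positive_definite_three_tents: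
  assumes "r \<ge> 0"
  shows "positive_definite (\<lambda>x. complex_of_real (three_tents l r x))"
proof -
  let ?H = "\<lambda>t. indicator {0..0 + r} t + indicator {l..l + r} t :: real"
  have "positive_definite (\<lambda>x. complex_of_real (\<integral>t. ?H (t + x) * ?H t \<partial>lborel))"
    by (rule positive_definite_autocorrelation)
      (rule integrable.intros[OF three_tents_autocorrelation[OF assms]])
  then show ?thesis
    by (simp only: has_bochner_integral_integral_eq[OF three_tents_autocorrelation[OF assms]])
qed

lemma support_three_tents:
  assumes "r < 1"
  shows "closure (support_on UNIV (three_tents l r)) \<subseteq> Omega l"
proof -
  let ?K = "{-r..r} \<union> {l - r..l + r} \<union> {- l - r..- l + r}"
  have zero: "tent r y = 0" if "y \<notin> {-r..r}" for y
    using that by (auto simp: tent_def)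
  have "three_tents l r x = 0" if "x \<notin> ?K" for x
  proof -
    have "x \<notin> {-r..r}" "x + l \<notin> {-r..r}" "x - l \<notin> {-r..r}"
      using that by auto
    then show ?thesis
      by (simp add: three_tents_def zero del: atLeastAtMost_iff)
  qed
  then have "support_on UNIV (three_tents l r) \<subseteq> ?K"
    by (auto simp only: support_on_def)
  then have "closure (support_on UNIV (three_tents l r)) \<subseteq> ?K"
    by (intro closure_minimal closed_Un closed_atLeastAtMost)
  also have "\<dots> \<subseteq> Omega l"
    using assms by (auto simp: Omega_def)
  finally show ?thesis .
qed

lemma turan_admissible_three_tents:
  assumes "0 < r" "r < 1" "r \<le> \<bar>l\<bar>"
  shows "turan_admissible (Omega l) (\<lambda>x. of_real (1 / (2 * r)) * of_real (three_tents l r x))"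
  unfolding turan_admissible_def
proof (intro conjI)
  show "continuous_on UNIV
      (\<lambda>x. of_real (1 / (2 * r)) * complex_of_real (three_tents l r x))"
    unfolding three_tents_def by (intro continuous_intros)
  show "positive_definite (\<lambda>x. of_real (1 / (2 * r)) * of_real (three_tents l r x))"
    using assms by (intro positive_definite_scale positive_definite_three_tents) auto
  show "of_real (1 / (2 * r)) * complex_of_real (three_tents l r 0) = 1"
    using assms by (simp add: three_tents_def tent_def)
  have "support_on UNIV (\<lambda>x. of_real (1 / (2 * r)) * complex_of_real (three_tents l r x))
      = support_on UNIV (three_tents l r)"
    using assms by (simp add: support_on_def)
  then show "closure (support_on UNIV
      (\<lambda>x. of_real (1 / (2 * r)) * complex_of_real (three_tents l r x))) \<subseteq> Omega l"
    using support_three_tents[OF assms(2)] by simp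
qed

lemma integral_three_tents:
  assumes "r \<ge> 0"
  shows "(\<integral>x. three_tents l r x \<partial>lborel) = 4 * r\<^sup>2"
proof -
  have "has_bochner_integral lborel (\<lambda>x. 2 * tent r (x + 0) + tent r (x + l) + tent r (x + - l))
      (2 * r\<^sup>2 + r\<^sup>2 + r\<^sup>2)"
    by (intro has_bochner_integral_add has_bochner_integral_mult_right
        has_bochner_integral_tent assms)
  then show ?thesis
    by (simp add: has_bochner_integral_iff three_tents_def)
qed

theorem mainTheorem8:
  fixes l :: real
  assumes "l > 2"
  shows "turan_constant (Omega l) \<ge> 2"
proof -
  have le: "ereal (2 * r) \<le> turan_constant (Omega l)" if r: "0 < r" "r < 1" for r
  proof -
    let ?f = "\<lambda>x. of_real (1 / (2 * r)) * complex_of_real (three_tents l r x)"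
    have "(\<integral>x. ?f x \<partial>lborel) = of_real (1 / (2 * r) * (4 * r\<^sup>2))"
      using r by (simp only: integral_mult_right_zero integral_complex_of_real
          integral_three_tents of_real_mult less_imp_le)
    then have "Re (\<integral>x. ?f x \<partial>lborel) = 2 * r"
      using r by (simp only: Re_complex_of_real) (simp add: power2_eq_square)
    moreover have "turan_admissible (Omega l) ?f"
      using r assms by (intro turan_admissible_three_tents) auto
    ultimately show ?thesis
      unfolding turan_constant_def by (intro SUP_upper2[of ?f]) auto
  qed
  have "((\<lambda>r. ereal (2 * r)) \<longlongrightarrow> ereal (2 * 1)) (at_left 1)"
    by (intro tendsto_intros)
  moreover have "\<forall>\<^sub>F r in at_left 1. ereal (2 * r) \<le> turan_constant (Omega l)"
    using eventually_at_left_real[OF zero_less_one] by eventually_elim (auto intro: le)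
  ultimately have "ereal (2 * 1) \<le> turan_constant (Omega l)"
    by (intro tendsto_upperbound) auto
  then show ?thesis
    by simp
qed

end
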